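(* $(CP_2)$ is a valid formulation of the $p$-center problem. That is, for every instance of the $p$-center problem, if $r^*$ is the optimal value of $(CP_2)$, then $D^{r^*}$ equals the optimal radius, and for every optimal solution $(y,r)$ of $(CP_2)$ the set of facilities $\{F_j : y_j=1\}$ is an optimal solution of the $p$-center problem.
   Context: An instance of the $p$-center problem consists of positive integers $N$ (number of clients $C_1,\dots,C_N$), $M$ (number of potential facility sites $F_1,\dots,F_M$) and $p$, and of distances $d_{ij}\ge 0$ between client $C_i$ and site $F_j$ for $i\in\mathcal N=\{1,\dots,N\}$, $j\in\mathcal M=\{1,\dots,M\}$. The problem is to choose a nonempty set $J\subseteq\mathcal M$ of at most $p$ open sites minimizing the radius $\max_{i\in\mathcal N}\min_{j\in J} d_{ij}$; the minimum is called the optimal radius. Let $D^0<D^1<\dots<D^K$ be the distinct values taken by the $d_{ij}$, with $K\ge 1$, and $\mathcal K=\{1,\dots,K\}$. For $i\in\mathcal N$ and $k\in\mathcal K$, let $N_i^k$ be the set of facilities located at distance less than $D^k$ from client $C_i$, i.e. those with $d_{ij}<D^k$. Let $S_i$ be the set of indices $k\in\{1,\dots,K-1\}$ such that $N_i^k\ne N_i^{k+1}$. Formulation $(CP_2)$ is the integer program with variables $y_j$ ($j\in\mathcal M$) and $r$ (which represents the index of a radius): $$\min\ r$$ subject to $$1\le \sum_{j=1}^M y_j\le p,\qquad r+k\sum_{j\,:\,d_{ij}<D^k} y_j\ge k\quad (i\in\mathcal N,\ k\in S_i\cup\{K\}),$$ $$y_j\in\{0,1\}\quad (j\in\mathcal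 M),\qquad r\in\{0,\dots,K\}.$$ *)

theory Defs
  imports Complex_Main
begin

text \<open>Clients are indexed by \<open>{1..N}\<close> and sites by \<open>{1..M}\<close>; only the values of
  \<open>d\<close>, \<open>D\<close> and \<open>y\<close> on the relevant index ranges matter.\<close>

definition p_center_instance :: "nat \<Rightarrow> nat \<Rightarrow> nat \<Rightarrow> (nat \<Rightarrow> nat \<Rightarrow> real) \<Rightarrow> bool" where
  "p_center_instance N M p d \<longleftrightarrow>
     N \<ge> 1 \<and> M \<ge> 1 \<and> p \<ge> 1 \<and> (\<forall>i\<in>{1..N}. \<forall>j\<in>{1..M}. d i j \<ge> 0)"

definition p_center_feasible :: "nat \<Rightarrow> nat \<Rightarrow> nat set \<Rightarrow> bool" where
  "p_center_feasible M p J \<longleftrightarrow> J \<subseteq> {1..M} \<and> J \<noteq> {} \<and> card J \<le> p"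

definition radius :: "nat \<Rightarrow> (nat \<Rightarrow> nat \<Rightarrow> real) \<Rightarrow> nat set \<Rightarrow> real" where
  "radius N d J = (MAX i\<in>{1..N}. MIN j\<in>J. d i j)"

definition optimal_radius :: "nat \<Rightarrow> nat \<Rightarrow> nat \<Rightarrow> (nat \<Rightarrow> nat \<Rightarrow> real) \<Rightarrow> real" where
  "optimal_radius N M p d = (MIN J\<in>{J. p_center_feasible M p J}. radius N d J)"

definition p_center_optimal ::
    "nat \<Rightarrow> nat \<Rightarrow> nat \<Rightarrow> (nat \<Rightarrow> nat \<Rightarrow> real) \<Rightarrow> nat set \<Rightarrow> bool" where
  "p_center_optimal N M p d J \<longleftrightarrow>
     p_center_feasible M p J \<and> (\<forall>J'. p_center_feasible M p J' \<longrightarrow> radius N d J \<le> radius N d J')"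

text \<open>\<open>D 0 < \<dots> < D K\<close> are the distinct values of the distances; this determines \<open>K\<close>,
  and \<open>D\<close> on \<open>{0..K}\<close>.\<close>

definition distinct_distances ::
    "nat \<Rightarrow> nat \<Rightarrow> (nat \<Rightarrow> nat \<Rightarrow> real) \<Rightarrow> nat \<Rightarrow> (nat \<Rightarrow> real) \<Rightarrow> bool" where
  "distinct_distances N M d K D \<longleftrightarrow>
     strict_mono_on {0..K} D \<and> D ` {0..K} = {d i j | i j. i \<in> {1..N} \<and> j \<in> {1..M}}"

definition near_sites ::
    "nat \<Rightarrow> (nat \<Rightarrow> nat \<Rightarrow> real) \<Rightarrow> (nat \<Rightarrow> real) \<Rightarrow> nat \<Rightarrow> nat \<Rightarrow> nat set" where
  "near_sites M d D i k = {j \<in> {1..M}. d i j < D k}"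

definition relevant_indices ::
    "nat \<Rightarrow> (nat \<Rightarrow> nat \<Rightarrow> real) \<Rightarrow> nat \<Rightarrow> (nat \<Rightarrow> real) \<Rightarrow> nat \<Rightarrow> nat set" where
  "relevant_indices M d K D i =
     {k \<in> {1..K - 1}. near_sites M d D i k \<noteq> near_sites M d D i (k + 1)}"

definition CP2_feasible ::
    "nat \<Rightarrow> nat \<Rightarrow> nat \<Rightarrow> (nat \<Rightarrow> nat \<Rightarrow> real) \<Rightarrow> nat \<Rightarrow> (nat \<Rightarrow> real) \<Rightarrow> (nat \<Rightarrow> nat) \<Rightarrow> nat \<Rightarrow> bool" where
  "CP2_feasible N M p d K D y r \<longleftrightarrow>
     1 \<le> (\<Sum>j=1..M. y j) \<and> (\<Sum>j=1..M. y j) \<le> p \<and>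
     (\<forall>i\<in>{1..N}. \<forall>k \<in> relevant_indices M d K D i \<union> {K}.
        r + k * (\<Sum>j | j \<in> {1..M} \<and> d i j < D k. y j) \<ge> k) \<and>
     (\<forall>j\<in>{1..M}. y j \<in> {0, 1}) \<and> r \<in> {0..K}"

definition CP2_value ::
    "nat \<Rightarrow> nat \<Rightarrow> nat \<Rightarrow> (nat \<Rightarrow> nat \<Rightarrow> real) \<Rightarrow> nat \<Rightarrow> (nat \<Rightarrow> real) \<Rightarrow> nat" where
  "CP2_value N M p d K D = Min {r. \<exists>y. CP2_feasible N M p d K D y r}"

definition CP2_optimal ::
    "nat \<Rightarrow> nat \<Rightarrow> nat \<Rightarrow> (nat \<Rightarrow> nat \<Rightarrow> real) \<Rightarrow> nat \<Rightarrow> (nat \<Rightarrow> real) \<Rightarrow> (nat \<Rightarrow> nat) \<Rightarrow> nat \<Rightarrow> bool" where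
  "CP2_optimal N M p d K D y r \<longleftrightarrow>
     CP2_feasible N M p d K D y r \<and> (\<forall>y' r'. CP2_feasible N M p d K D y' r' \<longrightarrow> r \<le> r')"

end

theory Submission
  imports Defs
begin

text \<open>A binary vector \<open>y\<close> and an index \<open>r\<close> satisfy the covering constraints exactly when the set
  \<open>J\<close> of open sites has radius at most \<open>D r\<close>. Indeed, if the site of \<open>J\<close> closest to client
  \<open>i\<close> is at distance \<open>D m\<close> with \<open>m > r\<close>, then \<open>m = K\<close> or that very site distinguishes the
  sites nearer than \<open>D m\<close> from those nearer than \<open>D (m + 1)\<close>; either way the constraint for \<open>i\<close>
  and \<open>m\<close> is present, and it is violated. Since the radius of a set is one of the \<open>D r\<close>,
  minimising \<open>r\<close> minimises the radius.\<close>

lemma radius_le_iff: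
  assumes "N \<ge> 1" "finite J" "J \<noteq> {}"
  shows "radius N d J \<le> t \<longleftrightarrow> (\<forall>i\<in>{1..N}. \<exists>j\<in>J. d i j \<le> t)"
  using assms by (simp add: radius_def Min_le_iff)

lemma radius_attained:
  assumes "N \<ge> 1" "finite J" "J \<noteq> {}"
  obtains i j where "i \<in> {1..N}" "j \<in> J" "radius N d J = d i j"
proof -
  have "radius N d J \<in> (\<lambda>i. MIN j\<in>J. d i j) ` {1..N}"
    unfolding radius_def using assms(1) by (intro Max_in) auto
  then obtain i where i: "i \<in> {1..N}" "radius N d J = (MIN j\<in>J. d i j)" by blast
  have "(MIN j\<in>J. d i j) \<in> d i ` J" using assms(2,3) by (intro Min_in) auto
  then show thesis using i that by auto
qed

lemma p_center_feasible_finite: "p_center_feasible M p J \<Longrightarrow> finite J"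
  by (auto simp: p_center_feasible_def intro: finite_subset)

lemma finite_p_center_feasible: "finite {J. p_center_feasible M p J}"
  by (rule finite_subset[of _ "Pow {1..M}"]) (auto simp: p_center_feasible_def)

lemma distance_index:
  assumes "distinct_distances N M d K D" "i \<in> {1..N}" "j \<in> {1..M}"
  obtains m where "m \<le> K" "d i j = D m"
proof -
  have "d i j \<in> D ` {0..K}" using assms by (auto simp: distinct_distances_def)
  then show thesis using that by auto
qed

text \<open>The maximum and the minimum are attained, so the radius is itself one of the distances
  and hence some \<open>D m\<close>. This lets every admissible set of sites compete in the integer
  program with the exact index of its radius.\<close>

lemma radius_index:
  assumes "distinct_distances N M d K D" "N \<ge> 1" "p_center_feasible M p J"
  obtains m where "m \<le> K" "radius N d J = D m"
proof -
  obtain i j where ij: "i \<in> {1..N}" "j \<in> J" "radius N d J = d i j"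
    using radius_attained assms(2,3) p_center_feasible_finite
    by (metis p_center_feasible_def)
  then have "j \<in> {1..M}" using assms(3) by (auto simp: p_center_feasible_def)
  then show thesis using distance_index[OF assms(1) ij(1)] ij(3) that by metis
qed

lemma distinct_distances_less_iff:
  assumes "distinct_distances N M d K D" "k \<le> K" "l \<le> K"
  shows "D k < D l \<longleftrightarrow> k < l"
proof -
  have sm: "strict_mono_on {0..K} D" using assms by (simp add: distinct_distances_def)
  show ?thesis
    using strict_mono_onD[OF sm, of k l] strict_mono_onD[OF sm, of l k] assms(2,3)
    by (cases k l rule: linorder_cases) auto
qed

text \<open>\<open>?cover\<close> is what the covering constraints say about a set of open sites: a
  constraint with no open site in its sum can only be met by \<open>k \<le> r\<close>.\<close>

lemma radius_le_iff_covering: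
  assumes D: "distinct_distances N M d K D" and N: "N \<ge> 1"
    and J: "p_center_feasible M p J" and r: "r \<le> K"
  shows "radius N d J \<le> D r \<longleftrightarrow>
    (\<forall>i\<in>{1..N}. \<forall>k\<in>relevant_indices M d K D i \<union> {K}. near_sites M d D i k \<inter> J = {} \<longrightarrow> k \<le> r)"
    (is "_ \<longleftrightarrow> ?cover")
proof -
  have fin: "finite J" using J by (rule p_center_feasible_finite)
  have ne: "J \<noteq> {}" and sub: "J \<subseteq> {1..M}" using J by (auto simp: p_center_feasible_def)
  note rad = radius_le_iff[OF N fin ne]
  show ?thesis
  proof
    assume le: "radius N d J \<le> D r"
    show ?cover
    proof (intro ballI impI)
      fix i k
      assume i: "i \<in> {1..N}" and k: "k \<in> relevant_indices M d K D i \<union> {K}"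
        and empty: "near_sites M d D i k \<inter> J = {}"
      have "k \<le> K" using k by (auto simp: relevant_indices_def)
      obtain j where j: "j \<in> J" "d i j \<le> D r" using le rad i by blast
      with empty sub have "D k \<le> d i j" by (force simp: near_sites_def)
      with j have "\<not> D r < D k" by simp
      then show "k \<le> r" using distinct_distances_less_iff[OF D r \<open>k \<le> K\<close>] by simp
    qed
  next
    assume cover: ?cover
    show "radius N d J \<le> D r"
      unfolding rad
    proof
      fix i assume i: "i \<in> {1..N}"
      obtain j where j: "j \<in> J" and min: "\<And>j'. j' \<in> J \<Longrightarrow> d i j \<le> d i j'"
        using ex_min_if_finite[of "d i ` J"] fin ne by (metis (no_types, lifting) image_iff
            image_is_empty finite_imageI linorder_not_less)
      obtain m where m: "m \<le> K" "d i j = D m" using distance_index[OF D i] j sub by blast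
      have "m \<le> r"
      proof (rule ccontr)
        assume "\<not> m \<le> r"
        \<comment> \<open>An open site strictly nearer than \<open>D m\<close> would contradict the
          choice of \<open>j\<close>.\<close>
        have "near_sites M d D i m \<inter> J = {}"
          using min m(2) by (force simp: near_sites_def)
        moreover have "m \<in> relevant_indices M d K D i \<union> {K}"
        proof (cases "m = K")
          case False
          then have "j \<in> near_sites M d D i (m + 1) - near_sites M d D i m"
            using m j sub distinct_distances_less_iff[OF D, of m "m + 1"]
            by (auto simp: near_sites_def)
          \<comment> \<open>The relevant indices start at 1; \<open>m \<ge> 1\<close> holds because
            \<open>m\<close> exceeds the natural number \<open>r\<close>.\<close>
          then show ?thesis using False m(1) \<open>\<not> m \<le> r\<close> by (auto simp: relevant_indices_def)
        qed simp
        ultimately show False using cover i \<open>\<not> m \<le> r\<close> by blast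
      qed
      then have "d i j \<le> D r"
        using distinct_distances_less_iff[OF D r m(1)] m(2) by simp
      then show "\<exists>j\<in>J. d i j \<le> D r" using j by blast
    qed
  qed
qed

text \<open>For binary \<open>y\<close> each sum counts open sites, so the factor \<open>k\<close>
  acts as a big-M: one nearby open site makes the constraint hold for every \<open>r\<close>, and
  none reduces it to \<open>k \<le> r\<close>.\<close>

lemma CP2_feasible_iff:
  assumes "distinct_distances N M d K D" "N \<ge> 1"
  shows "CP2_feasible N M p d K D y r \<longleftrightarrow>
    (\<forall>j\<in>{1..M}. y j \<in> {0, 1}) \<and> r \<le> K \<and> p_center_feasible M p {j \<in> {1..M}. y j = 1} \<and>
    radius N d {j \<in> {1..M}. y j = 1} \<le> D r"
\<comment> \<open>If \<open>y\<close> is not binary or \<open>r\<close> exceeds \<open>K\<close>,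
  both sides are false.\<close>
proof (cases "(\<forall>j\<in>{1..M}. y j \<in> {0, 1}) \<and> r \<le> K")
  case True
  let ?J = "{j \<in> {1..M}. y j = 1}"
  have sum_y: "(\<Sum>j\<in>A. y j) = card (A \<inter> ?J)" if "A \<subseteq> {1..M}" for A
  proof -
    have "finite A" using that by (rule finite_subset) simp
    have "(\<Sum>j\<in>A. y j) = (\<Sum>j\<in>A. if j \<in> ?J then 1 else 0)"
      using True that by (intro sum.cong) auto
    then show ?thesis using \<open>finite A\<close> by (simp add: sum.If_cases Int_def)
  qed
  have "{1..M} \<inter> ?J = ?J" by blast
  then have "(\<Sum>j=1..M. y j) = card ?J" using sum_y[of "{1..M}"] by simp
  then have feas: "1 \<le> (\<Sum>j=1..M. y j) \<and> (\<Sum>j=1..M. y j) \<le> p \<longleftrightarrow> p_center_feasible M p ?J"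
    by (auto simp: p_center_feasible_def Suc_le_eq card_gt_0_iff)
  have cover: "k \<le> r + k * (\<Sum>j | j \<in> {1..M} \<and> d i j < D k. y j) \<longleftrightarrow>
      (near_sites M d D i k \<inter> ?J = {} \<longrightarrow> k \<le> r)" for i k
  proof -
    have s: "(\<Sum>j | j \<in> {1..M} \<and> d i j < D k. y j) = card (near_sites M d D i k \<inter> ?J)"
      unfolding near_sites_def by (rule sum_y) blast
    have "k \<le> k * card (near_sites M d D i k \<inter> ?J)" if "near_sites M d D i k \<inter> ?J \<noteq> {}"
      using that by (simp add: Suc_le_eq card_gt_0_iff)
    then show ?thesis
      unfolding s by (cases "near_sites M d D i k \<inter> ?J = {}") (auto intro: trans_le_add2)
  qed
  show ?thesis
    using True feas radius_le_iff_covering[OF assms, of p ?J r]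
    unfolding CP2_feasible_def cover by auto
qed (auto simp: CP2_feasible_def)

text \<open>The indicator vector of \<open>J\<close> recovers \<open>J\<close> as its set of open
  sites.\<close>

lemma CP2_feasible_of_set:
  assumes "distinct_distances N M d K D" "N \<ge> 1" "p_center_feasible M p J"
    and "m \<le> K" "radius N d J \<le> D m"
  shows "CP2_feasible N M p d K D (\<lambda>j. of_bool (j \<in> J)) m"
proof -
  have "{j \<in> {1..M}. of_bool (j \<in> J) = (1::nat)} = J"
    using assms(3) by (auto simp: p_center_feasible_def)
  then show ?thesis using assms by (simp add: CP2_feasible_iff)
qed

text \<open>Feasibility bounds the radius above by \<open>D r\<close>. Conversely, an admissible set
  of radius \<open>D m\<close> makes \<open>m\<close> a feasible value, so \<open>r \<le> m\<close>
  and no radius lies below \<open>D r\<close>; for the open sites of \<open>y\<close> the two bounds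
  meet.\<close>

lemma CP2_optimal_radius:
  assumes D: "distinct_distances N M d K D" and N: "N \<ge> 1"
    and opt: "CP2_optimal N M p d K D y r"
  shows "p_center_optimal N M p d {j \<in> {1..M}. y j = 1}"
    and "radius N d {j \<in> {1..M}. y j = 1} = D r"
proof -
  let ?J = "{j \<in> {1..M}. y j = 1}"
  have J: "r \<le> K" "p_center_feasible M p ?J" "radius N d ?J \<le> D r"
    using opt by (auto simp: CP2_optimal_def CP2_feasible_iff[OF D N])
  have lower: "D r \<le> radius N d J'" if J': "p_center_feasible M p J'" for J'
  proof -
    obtain m where m: "m \<le> K" "radius N d J' = D m" using radius_index[OF D N J'] .
    then have "r \<le> m"
      using opt CP2_feasible_of_set[OF D N J' m(1)] by (auto simp: CP2_optimal_def)
    then show ?thesis using distinct_distances_less_iff[OF D m(1) J(1)] m(2) by simp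
  qed
  show "radius N d ?J = D r" using J(3) lower[OF J(2)] by simp
  then show "p_center_optimal N M p d ?J"
    using J(2) lower by (auto simp: p_center_optimal_def)
qed

lemma optimal_radius_eq:
  assumes "p_center_optimal N M p d J"
  shows "optimal_radius N M p d = radius N d J"
  unfolding optimal_radius_def
  using assms finite_p_center_feasible by (intro Min_eqI) (auto simp: p_center_optimal_def)

lemma CP2_value_eq:
  assumes "CP2_optimal N M p d K D y r"
  shows "CP2_value N M p d K D = r"
proof -
  have "finite {r. \<exists>y. CP2_feasible N M p d K D y r}"
    by (rule finite_subset[of _ "{0..K}"]) (auto simp: CP2_feasible_def)
  then show ?thesis
    unfolding CP2_value_def using assms by (intro Min_eqI) (auto simp: CP2_optimal_def)
qed

text \<open>Objective values are natural numbers, so one feasible point suffices for the minimum to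
  be attained.\<close>

lemma CP2_optimal_exists:
  assumes "CP2_feasible N M p d K D y r"
  shows "\<exists>y r. CP2_optimal N M p d K D y r"
proof -
  define r' where "r' = (LEAST r. \<exists>y. CP2_feasible N M p d K D y r)"
  have "\<exists>y. CP2_feasible N M p d K D y r'"
    unfolding r'_def by (rule LeastI_ex) (use assms in blast)
  moreover have "r' \<le> s" if "CP2_feasible N M p d K D z s" for z s
    unfolding r'_def by (rule Least_le) (use that in blast)
  ultimately show ?thesis by (auto simp: CP2_optimal_def)
qed

theorem proposition4:
  fixes N M p K :: nat
    and d :: "nat \<Rightarrow> nat \<Rightarrow> real"
    and D :: "nat \<Rightarrow> real"
  assumes "p_center_instance N M p d"
    and "distinct_distances N M d K D"
    and "K \<ge> 1"
  shows "(\<exists>y r. CP2_optimal N M p d K D y r)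
    \<and> D (CP2_value N M p d K D) = optimal_radius N M p d
    \<and> (\<forall>y r. CP2_optimal N M p d K D y r \<longrightarrow>
          p_center_optimal N M p d {j \<in> {1..M}. y j = 1})"
proof -
  \<comment> \<open>Opening site 1 alone is admissible as \<open>M\<close> and \<open>p\<close> are
    positive; this makes the integer program feasible.\<close>
  have N: "N \<ge> 1" and J: "p_center_feasible M p {1}"
    using assms(1) by (auto simp: p_center_instance_def p_center_feasible_def)
  obtain m where m: "m \<le> K" "radius N d {1} = D m"
    using radius_index[OF assms(2) N J] .
  then have "CP2_feasible N M p d K D (\<lambda>j. of_bool (j \<in> {1})) m"
    by (intro CP2_feasible_of_set[OF assms(2) N J]) auto
  then obtain y r where opt: "CP2_optimal N M p d K D y r"
    using CP2_optimal_exists by blast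
  have "D (CP2_value N M p d K D) = optimal_radius N M p d"
    using CP2_value_eq[OF opt] CP2_optimal_radius[OF assms(2) N opt] optimal_radius_eq by metis
  then show ?thesis using opt CP2_optimal_radius(1)[OF assms(2) N] by blast
qed

end
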